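(* For all non-negative integers $k,r$, $$\sum_{n=k}^\infty S^B_{n+r,k+r,r}\,\frac{z^n}{n!}=\frac{1}{k!\,2^k}\,e^{(2r+1)z}\,(e^{2z}-1)^k$$ as formal power series in $z$.
   Context: A set partition of $[\pm n]=\{\pm1,\dots,\pm n\}$ of type $B$ is a set partition of $[\pm n]$ such that (i) if $B$ is a block then $-B=\{-b: b\in B\}$ is also a block, and (ii) there is at most one block with $B=-B$ (called the zero block). The non-zero blocks come in pairs $\{B,-B\}$, and each pair is counted as one (representative) non-zero block. $S^B_{n,k,r}$ (the $r$-Stirling number of the second kind of type $B$) is the number of set partitions of $[\pm n]$ of type $B$ with exactly $k$ (representative) non-zero blocks in which none of $1,\dots,r$ lies in the zero block and $1,\dots,r$ lie in pairwise distinct pairs $\{B,-B\}$; in particular $S^B_{r,k,r}=\delta_{kr}$. *)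

theory Defs
  imports
    "HOL-Library.Disjoint_Sets"
    "HOL-Computational_Algebra.Formal_Power_Series"
begin

definition signed_interval :: "nat \<Rightarrow> int set" where
  "signed_interval n = {- int n..int n} - {0}"

definition type_B_partition :: "nat \<Rightarrow> int set set \<Rightarrow> bool" where
  "type_B_partition n P \<longleftrightarrow>
     partition_on (signed_interval n) P \<and>
     (\<forall>B\<in>P. uminus ` B \<in> P) \<and>
     (\<forall>B\<in>P. \<forall>C\<in>P. uminus ` B = B \<longrightarrow> uminus ` C = C \<longrightarrow> B = C)"

text \<open>The two non-zero blocks \<open>B\<close> and \<open>-B\<close> are identified, so that they are counted once.\<close>

definition nonzero_block_pairs :: "int set set \<Rightarrow> int set set set" where
  "nonzero_block_pairs P = {{B, uminus ` B} | B. B \<in> P \<and> uminus ` B \<noteq> B}"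

text \<open>
  The first condition says that none of \<open>1, \<dots>, r\<close> lies in the zero block. It is phrased so that
  \<open>1, \<dots>, r\<close> are also required to be elements of the underlying set; hence the number of
  such partitions is \<open>0\<close> if \<open>n < r\<close>.
\<close>

definition r_separated :: "nat \<Rightarrow> int set set \<Rightarrow> bool" where
  "r_separated r P \<longleftrightarrow>
     (\<forall>i\<in>{1..int r}. \<exists>B\<in>P. i \<in> B \<and> uminus ` B \<noteq> B) \<and>
     (\<forall>i\<in>{1..int r}. \<forall>j\<in>{1..int r}. i \<noteq> j \<longrightarrow>
        (\<forall>B\<in>P. \<forall>C\<in>P. i \<in> B \<longrightarrow> j \<in> C \<longrightarrow> {B, uminus ` B} \<noteq> {C, uminus ` C}))"

definition r_Stirling_B :: "nat \<Rightarrow> nat \<Rightarrow> nat \<Rightarrow> nat" where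
  "r_Stirling_B n k r =
     card {P. type_B_partition n P \<and> card (nonzero_block_pairs P) = k \<and> r_separated r P}"

end

theory Submission
  imports Defs
begin

text \<open>
  The numbers \<open>S n k\<close> of type B partitions of \<open>[\<plusminus>n]\<close> with \<open>k\<close> pairs of non-zero blocks that separate
  \<open>1, \<dots>, r\<close> satisfy, for \<open>n \<ge> r\<close>,
  \<open>S (n + 1) k = S n (k - 1) + (2 * k + 1) * S n k\<close>.
  Indeed, deleting \<open>n + 1\<close> and \<open>-(n + 1)\<close> from such a partition of \<open>[\<plusminus>(n + 1)]\<close> leaves
  such a partition of \<open>[\<plusminus>n]\<close>. Conversely, \<open>n + 1\<close> can be put back in three ways. It can form a new
  block on its own, which raises the number of pairs by one. It can join the zero block, together
  with \<open>-(n + 1)\<close> (and the two form the zero block if there was none). Or it can join one of the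
  \<open>2 * k\<close> non-zero blocks, while \<open>-(n + 1)\<close> joins the opposite block. The block that contains
  \<open>n + 1\<close> records the choice, so that this is a bijection
  (\<open>inj_on_insert_block\<close> and \<open>image_insert_block\<close>), and \<open>r_Stirling_B_Suc\<close> follows by counting.
  For \<open>n = r\<close> only the partition into singletons separates \<open>1, \<dots>, r\<close>
  (\<open>r_Stirling_B_diag\<close>).

  On the other side, let \<open>F k\<close> be the claimed generating function, with \<open>F (-1) = 0\<close>.
  Differentiation gives \<open>F' k = F (k - 1) + (2 * (k + r) + 1) * F k\<close>
  (\<open>r_Stirling_B_egf_deriv\<close>). So the numbers \<open>n! * [z^n] F k\<close> obey the recurrence of
  \<open>S (n + r) (k + r)\<close>, and for \<open>n = 0\<close> both are \<open>1\<close> if \<open>k = 0\<close> and \<open>0\<close> otherwise. Both families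
  therefore agree, by induction on \<open>n\<close>.
\<close>

section \<open>Blocks of type B partitions\<close>

definition nonzero_blocks :: "int set set \<Rightarrow> int set set" where
  "nonzero_blocks P = {B \<in> P. uminus ` B \<noteq> B}"

text \<open>
  The zero block if there is one, and the empty set otherwise. This lets the largest element join the
  zero block and create a new one in the same way.
\<close>

definition zero_part :: "int set set \<Rightarrow> int set" where
  "zero_part P = \<Union>{B \<in> P. uminus ` B = B}"

lemma mem_uminus_image_iff: "(x::int) \<in> uminus ` B \<longleftrightarrow> - x \<in> B"
  by force

lemma uminus_uminus_image: "uminus ` uminus ` B = (B :: int set)"
  by (simp add: image_image)

lemma mem_signed_interval: "x \<in> signed_interval n \<longleftrightarrow> x \<noteq> 0 \<and> - int n \<le> x \<and> x \<le> int n"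
  by (auto simp: signed_interval_def)

lemma signed_interval_Suc:
  "signed_interval (Suc n) = signed_interval n \<union> {int (Suc n), - int (Suc n)}"
  by (auto simp: signed_interval_def)

lemma uminus_signed_interval: "- x \<in> signed_interval n \<longleftrightarrow> x \<in> signed_interval n"
  by (auto simp: mem_signed_interval)

lemma uminus_Int_signed_interval:
  "uminus ` (signed_interval n \<inter> D) = signed_interval n \<inter> uminus ` D"
  by (auto simp: mem_uminus_image_iff uminus_signed_interval)

lemma partition_on_iff_unique:
  "partition_on A P \<longleftrightarrow> {} \<notin> P \<and> \<Union>P = A \<and> (\<forall>B\<in>P. \<forall>C\<in>P. \<forall>x. x \<in> B \<longrightarrow> x \<in> C \<longrightarrow> B = C)"
  unfolding partition_on_def disjoint_def by blast

lemma
  assumes "type_B_partition n P"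
  shows type_B_nonempty: "B \<in> P \<Longrightarrow> B \<noteq> {}"
    and type_B_Union: "\<Union>P = signed_interval n"
    and type_B_block_unique: "B \<in> P \<Longrightarrow> C \<in> P \<Longrightarrow> x \<in> B \<Longrightarrow> x \<in> C \<Longrightarrow> B = C"
    and type_B_uminus: "B \<in> P \<Longrightarrow> uminus ` B \<in> P"
    and type_B_zero_unique:
      "B \<in> P \<Longrightarrow> C \<in> P \<Longrightarrow> uminus ` B = B \<Longrightarrow> uminus ` C = C \<Longrightarrow> B = C"
proof -
  have P: "partition_on (signed_interval n) P"
    and U: "\<forall>B\<in>P. uminus ` B \<in> P"
    and Z: "\<forall>B\<in>P. \<forall>C\<in>P. uminus ` B = B \<longrightarrow> uminus ` C = C \<longrightarrow> B = C"
    using assms unfolding type_B_partition_def by (blast intro: conjunct1 conjunct2)+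
  show "B \<in> P \<Longrightarrow> B \<noteq> {}" and "\<Union>P = signed_interval n"
    using P unfolding partition_on_def by auto
  show "B \<in> P \<Longrightarrow> C \<in> P \<Longrightarrow> x \<in> B \<Longrightarrow> x \<in> C \<Longrightarrow> B = C"
    using P unfolding partition_on_iff_unique by meson
  show "B \<in> P \<Longrightarrow> uminus ` B \<in> P"
    by (rule U[rule_format])
  show "B \<in> P \<Longrightarrow> C \<in> P \<Longrightarrow> uminus ` B = B \<Longrightarrow> uminus ` C = C \<Longrightarrow> B = C"
    by (rule Z[rule_format])
qed

lemma type_B_zero_iff:
  assumes "type_B_partition n P" "B \<in> P" "x \<in> B"
  shows "uminus ` B = B \<longleftrightarrow> - x \<in> B"
proof
  assume "- x \<in> B"
  then have "x \<in> uminus ` B" by (simp add: mem_uminus_image_iff)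
  then show "uminus ` B = B"
    using assms type_B_block_unique type_B_uminus by metis
qed (use assms(3) in auto)

lemma finite_type_B_partitions: "finite {P. type_B_partition n P}"
proof (rule finite_subset)
  show "{P. type_B_partition n P} \<subseteq> Pow (Pow (signed_interval n))"
    using type_B_Union by blast
qed (simp add: signed_interval_def)

lemma finite_type_B_partition:
  assumes "type_B_partition n P"
  shows "finite P"
proof (rule finite_subset)
  show "P \<subseteq> Pow (signed_interval n)"
    using type_B_Union[OF assms] by blast
qed (simp add: signed_interval_def)

lemma nonzero_block_pairsE:
  assumes "p \<in> nonzero_block_pairs P"
  obtains B where "p = {B, uminus ` B}" "B \<in> P" "uminus ` B \<noteq> B"
  using assms unfolding nonzero_block_pairs_def mem_Collect_eq
  by (elim exE conjE) (rule that)

text \<open>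
  Counting blocks instead of pairs makes the effect of an insertion on the statistic a matter of
  adding and removing members of one set.
\<close>

lemma card_nonzero_blocks:
  assumes "type_B_partition n P"
  shows "card (nonzero_blocks P) = 2 * card (nonzero_block_pairs P)"
proof -
  have U: "\<Union>(nonzero_block_pairs P) = nonzero_blocks P"
  proof (intro equalityI subsetI)
    fix B assume "B \<in> \<Union>(nonzero_block_pairs P)"
    then obtain C where C: "C \<in> P" "uminus ` C \<noteq> C" "B \<in> {C, uminus ` C}"
      by (metis UnionE nonzero_block_pairsE)
    then show "B \<in> nonzero_blocks P"
      using type_B_uminus[OF assms C(1)] unfolding nonzero_blocks_def
      by (metis (mono_tags, lifting) insertE mem_Collect_eq singletonD uminus_uminus_image)
  next
    fix B assume "B \<in> nonzero_blocks P"
    then show "B \<in> \<Union>(nonzero_block_pairs P)"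
      unfolding nonzero_block_pairs_def nonzero_blocks_def by blast
  qed
  have fin: "finite (nonzero_blocks P)"
    using finite_type_B_partition[OF assms] by (simp add: nonzero_blocks_def)
  have "2 * card (nonzero_block_pairs P) = card (\<Union>(nonzero_block_pairs P))"
  proof (rule card_partition)
    show "finite (nonzero_block_pairs P)"
      using fin U by (metis finite_UnionD)
    show "finite (\<Union>(nonzero_block_pairs P))"
      using fin U by simp
    show "card c = 2" if "c \<in> nonzero_block_pairs P" for c
      using that by (elim nonzero_block_pairsE) (metis card_2_iff)
    show "c \<inter> d = {}" if cd: "c \<in> nonzero_block_pairs P" "d \<in> nonzero_block_pairs P" "c \<noteq> d" for c d
    proof -
      obtain B where B: "c = {B, uminus ` B}"
        using cd(1) by (rule nonzero_block_pairsE)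
      obtain C where C: "d = {C, uminus ` C}"
        using cd(2) by (rule nonzero_block_pairsE)
      have "B \<noteq> C" "B \<noteq> uminus ` C" "uminus ` B \<noteq> C" "uminus ` B \<noteq> uminus ` C"
        using cd(3) uminus_uminus_image[of B] uminus_uminus_image[of C]
        unfolding B C by (metis insert_commute)+
      then show ?thesis
        unfolding B C by simp
    qed
  qed
  with U show ?thesis by simp
qed

text \<open>
  The two conditions in the definition of separation are one: negation preserves the partition, so
  that excluding \<open>-i\<close> from the block of \<open>i\<close> keeps \<open>i\<close> out of the zero block, and excluding \<open>\<plusminus>j\<close> keeps
  \<open>i\<close> and \<open>j\<close> in different pairs. In this form the condition depends only on the traces of the
  blocks on \<open>[\<plusminus>r]\<close>, hence it is unaffected by elements beyond \<open>r\<close>.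
\<close>

lemma r_separated_iff:
  assumes P: "type_B_partition n P" and "r \<le> n"
  shows "r_separated r P \<longleftrightarrow>
    (\<forall>B\<in>P. \<forall>i\<in>signed_interval r. \<forall>j\<in>signed_interval r. i \<in> B \<longrightarrow> j \<in> B \<longrightarrow> i = j)"
  (is "_ \<longleftrightarrow> ?R")
proof
  assume sep: "r_separated r P"
  have pos: "j = i" if B: "B \<in> P" and i: "i \<in> {1..int r}" "i \<in> B"
    and j: "j \<in> signed_interval r" "j \<in> B" for B i j
  proof -
    obtain B' where "B' \<in> P" "i \<in> B'" "uminus ` B' \<noteq> B'"
      using sep i unfolding r_separated_def by blast
    then have nz: "uminus ` B \<noteq> B"
      using type_B_block_unique[OF P] B i by metis
    show ?thesis
    proof (cases "j > 0")
      case True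
      with j have "j \<in> {1..int r}" by (auto simp: mem_signed_interval)
      then show ?thesis
        using sep i j B unfolding r_separated_def by metis
    next
      case False
      with j have j': "- j \<in> {1..int r}" by (auto simp: mem_signed_interval)
      have mj: "- j \<in> uminus ` B" using j by simp
      have "i = - j"
      proof (rule ccontr)
        assume "i \<noteq> - j"
        then have "{B, uminus ` B} \<noteq> {uminus ` B, uminus ` uminus ` B}"
          using sep i j' B mj type_B_uminus[OF P B] unfolding r_separated_def by metis
        then show False by (auto simp: uminus_uminus_image)
      qed
      then have "- i \<in> B" using j by simp
      then show ?thesis using type_B_zero_iff[OF P B i(2)] nz by simp
    qed
  qed
  show ?R
  proof (intro ballI impI)
    fix B i j
    assume *: "B \<in> P" "i \<in> signed_interval r" "j \<in> signed_interval r" "i \<in> B" "j \<in> B"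
    show "i = j"
    proof (cases "i > 0")
      case True
      with * have "i \<in> {1..int r}" by (auto simp: mem_signed_interval)
      then show ?thesis using pos[OF *(1) _ *(4) *(3) *(5)] by simp
    next
      case False
      with * have "- i \<in> {1..int r}" by (auto simp: mem_signed_interval)
      then have "- j = - i"
        using pos[OF type_B_uminus[OF P *(1)], of "- i" "- j"] *
        by (simp add: uminus_signed_interval)
      then show ?thesis by simp
    qed
  qed
next
  assume R: ?R
  show "r_separated r P"
    unfolding r_separated_def
  proof (intro conjI ballI impI)
    fix i assume i: "i \<in> {1..int r}"
    then have "i \<in> signed_interval n" using \<open>r \<le> n\<close> by (auto simp: mem_signed_interval)
    then obtain B where B: "B \<in> P" "i \<in> B" using type_B_Union[OF P] by blast
    moreover have "- i \<notin> B"
    proof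
      assume "- i \<in> B"
      moreover have "i \<in> signed_interval r" "- i \<in> signed_interval r"
        using i by (auto simp: mem_signed_interval)
      ultimately have "i = - i" using R B by metis
      then show False using i by simp
    qed
    ultimately show "\<exists>B\<in>P. i \<in> B \<and> uminus ` B \<noteq> B"
      using type_B_zero_iff[OF P] by metis
  next
    fix i j B C
    assume *: "i \<in> {1..int r}" "j \<in> {1..int r}" "i \<noteq> j" "B \<in> P" "C \<in> P" "i \<in> B" "j \<in> C"
    have S: "i \<in> signed_interval r" "j \<in> signed_interval r" "- j \<in> signed_interval r"
      using * by (auto simp: mem_signed_interval)
    have "j \<notin> B" using R S * by metis
    moreover have "- j \<notin> B"
    proof
      assume "- j \<in> B"
      then have "i = - j" using R S * by metis
      then show False using * by simp
    qed
    ultimately have "B \<noteq> C" "B \<noteq> uminus ` C"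
      using * by auto
    then show "{B, uminus ` B} \<noteq> {C, uminus ` C}" by blast
  qed
qed

section \<open>Deleting and inserting the largest element\<close>

definition delete_largest :: "nat \<Rightarrow> int set set \<Rightarrow> int set set" where
  "delete_largest n P = (\<inter>) (signed_interval n) ` P - {{}}"

text \<open>
  Here \<open>D\<close> is the block that is to contain \<open>n + 1\<close>. The old block that it extends can be read off
  as the trace of \<open>D\<close> on \<open>[\<plusminus>n]\<close>; an empty trace means that no old block is extended.
\<close>

definition insert_block :: "nat \<Rightarrow> int set set \<Rightarrow> int set \<Rightarrow> int set set" where
  "insert_block n Q D =
     (Q - {signed_interval n \<inter> D, uminus ` (signed_interval n \<inter> D)}) \<union> {D, uminus ` D}"

text \<open>
  The possible blocks of \<open>n + 1\<close>, apart from the singleton. The singleton is kept separate because it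
  is the only choice that adds a pair of non-zero blocks.
\<close>

definition merged_blocks :: "nat \<Rightarrow> int set set \<Rightarrow> int set set" where
  "merged_blocks n Q = insert (zero_part Q \<union> {int (Suc n), - int (Suc n)})
     (insert (int (Suc n)) ` nonzero_blocks Q)"

lemma delete_largest_type_B:
  assumes P: "type_B_partition (Suc n) P"
  shows "type_B_partition n (delete_largest n P)"
  unfolding type_B_partition_def
proof (intro conjI ballI impI)
  have "signed_interval n \<inter> signed_interval (Suc n) = signed_interval n"
    by (auto simp: mem_signed_interval)
  then show "partition_on (signed_interval n) (delete_largest n P)"
    using P partition_on_restrict[of "signed_interval (Suc n)" P "signed_interval n"]
    unfolding type_B_partition_def delete_largest_def by simp
next
  fix B assume "B \<in> delete_largest n P"
  then obtain B' where B': "B' \<in> P" "B = signed_interval n \<inter> B'" "B \<noteq> {}"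
    by (auto simp: delete_largest_def)
  have "uminus ` B = signed_interval n \<inter> uminus ` B'"
    by (auto simp: B' mem_uminus_image_iff uminus_signed_interval)
  then show "uminus ` B \<in> delete_largest n P"
    using B' type_B_uminus[OF P] by (auto simp: delete_largest_def)
next
  have zero: "\<exists>B'\<in>P. B = signed_interval n \<inter> B' \<and> uminus ` B' = B'"
    if B: "B \<in> delete_largest n P" and "uminus ` B = B" for B
  proof -
    obtain B' x where B': "B' \<in> P" "B = signed_interval n \<inter> B'" "x \<in> B"
      using B by (auto simp: delete_largest_def)
    then have "- x \<in> B'" using \<open>uminus ` B = B\<close> by blast
    then show ?thesis using B' type_B_zero_iff[OF P] by blast
  qed
  fix B C
  assume "B \<in> delete_largest n P" "C \<in> delete_largest n P" "uminus ` B = B" "uminus ` C = C"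
  then show "B = C" using zero type_B_zero_unique[OF P] by metis
qed

text \<open>
  These are the only choices: the block of \<open>n + 1\<close> either is the zero block, or omits \<open>-(n + 1)\<close>. In
  the second case its trace on \<open>[\<plusminus>n]\<close> is empty or a non-zero block.
\<close>

lemma largest_block_cases:
  assumes P: "type_B_partition (Suc n) P" and D: "D \<in> P" "int (Suc n) \<in> D"
  shows "D \<in> insert {int (Suc n)} (merged_blocks n (delete_largest n P))"
proof -
  let ?m = "int (Suc n)" and ?S = "signed_interval n" and ?Q = "delete_largest n P"
  have Dsub: "D \<subseteq> ?S \<union> {?m, - ?m}"
    using type_B_Union[OF P] D by (auto simp: signed_interval_Suc)
  show ?thesis
  proof (cases "uminus ` D = D")
    case True
    have m: "- ?m \<in> D" using type_B_zero_iff[OF P D] True by simp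
    have "zero_part ?Q = ?S \<inter> D"
    proof
      show "zero_part ?Q \<subseteq> ?S \<inter> D"
      proof
        fix x assume "x \<in> zero_part ?Q"
        then obtain B where B: "B \<in> P" "uminus ` (?S \<inter> B) = ?S \<inter> B" "x \<in> ?S \<inter> B"
          by (auto simp: zero_part_def delete_largest_def)
        then have "- x \<in> B" by blast
        then have "uminus ` B = B" using type_B_zero_iff[OF P B(1)] B(3) by blast
        then have "B = D" using type_B_zero_unique[OF P B(1) D(1)] True by blast
        then show "x \<in> ?S \<inter> D" using B by simp
      qed
      have "uminus ` (?S \<inter> D) = ?S \<inter> D"
        by (simp only: uminus_Int_signed_interval True)
      then show "?S \<inter> D \<subseteq> zero_part ?Q"
        using D by (auto simp: zero_part_def delete_largest_def)
    qed
    then have "D = zero_part ?Q \<union> {?m, - ?m}"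
      using Dsub D m by blast
    then show ?thesis by (simp add: merged_blocks_def)
  next
    case False
    have m: "- ?m \<notin> D" using type_B_zero_iff[OF P D] False by simp
    then have eq: "D = insert ?m (?S \<inter> D)" using Dsub D by blast
    show ?thesis
    proof (cases "?S \<inter> D = {}")
      case True
      then show ?thesis using eq by simp
    next
      case ne: False
      then obtain x where x: "x \<in> ?S \<inter> D" by blast
      have "uminus ` (?S \<inter> D) \<noteq> ?S \<inter> D"
      proof
        assume "uminus ` (?S \<inter> D) = ?S \<inter> D"
        then have "- x \<in> D" using x by blast
        then show False using type_B_zero_iff[OF P D(1)] x False by blast
      qed
      then have "?S \<inter> D \<in> nonzero_blocks ?Q"
        using D ne by (auto simp: nonzero_blocks_def delete_largest_def)
      then show ?thesis using eq unfolding merged_blocks_def by blast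
    qed
  qed
qed

text \<open>
  All blocks other than \<open>D\<close> and \<open>-D\<close> lie in \<open>[\<plusminus>n]\<close>, since \<open>D\<close> and \<open>-D\<close> contain \<open>n + 1\<close> and
  \<open>-(n + 1)\<close>; deletion therefore leaves them unchanged.
\<close>

lemma insert_block_delete_largest:
  assumes P: "type_B_partition (Suc n) P" and D: "D \<in> P" "int (Suc n) \<in> D"
  shows "insert_block n (delete_largest n P) D = P"
proof -
  let ?m = "int (Suc n)" and ?S = "signed_interval n" and ?Q = "delete_largest n P"
  have D': "uminus ` D \<in> P" "- ?m \<in> uminus ` D"
    using type_B_uminus[OF P D(1)] imageI[OF D(2), of uminus] by simp_all
  have other: "?S \<inter> B = B" if B: "B \<in> P" "B \<noteq> D" "B \<noteq> uminus ` D" for B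
  proof -
    have "?m \<notin> B" "- ?m \<notin> B" using type_B_block_unique[OF P] B D D' by metis+
    moreover have "B \<subseteq> ?S \<union> {?m, - ?m}"
      using type_B_Union[OF P] B by (auto simp: signed_interval_Suc)
    ultimately show ?thesis by blast
  qed
  show ?thesis
  proof
    show "insert_block n ?Q D \<subseteq> P"
    proof
      fix B assume "B \<in> insert_block n ?Q D"
      then consider "B = D" | "B = uminus ` D"
        | "B \<in> ?Q" "B \<noteq> ?S \<inter> D" "B \<noteq> ?S \<inter> uminus ` D"
        unfolding insert_block_def uminus_Int_signed_interval by blast
      then show "B \<in> P"
      proof cases
        case 3
        then obtain B' where B': "B' \<in> P" "B = ?S \<inter> B'"
          unfolding delete_largest_def by blast
        then have "B' \<noteq> D" "B' \<noteq> uminus ` D" using 3 by blast+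
        then show ?thesis using other B' by simp
      qed (use D D' in simp_all)
    qed
    show "P \<subseteq> insert_block n ?Q D"
    proof
      fix B assume B: "B \<in> P"
      show "B \<in> insert_block n ?Q D"
      proof (cases "B = D \<or> B = uminus ` D")
        case True
        then show ?thesis by (auto simp: insert_block_def)
      next
        case False
        then have SB: "?S \<inter> B = B" using other B by blast
        have ne: "B \<noteq> {}" using type_B_nonempty[OF P B] .
        then have "B \<noteq> ?S \<inter> D" "B \<noteq> ?S \<inter> uminus ` D"
          using False type_B_block_unique[OF P B] D D' by blast+
        moreover have "B \<in> ?Q"
          using SB B ne unfolding delete_largest_def by blast
        ultimately show ?thesis by (simp add: insert_block_def uminus_Int_signed_interval)
      qed
    qed
  qed
qed

lemma zero_part_block:
  assumes "type_B_partition n Q" "B \<in> Q" "uminus ` B = B"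
  shows "zero_part Q = B"
  using assms type_B_zero_unique[OF assms(1)] unfolding zero_part_def by blast

lemma uminus_zero_part: "uminus ` zero_part Q = zero_part Q"
  unfolding zero_part_def by (simp add: image_Union)

lemma zero_part_empty_or_block:
  assumes "type_B_partition n Q"
  shows "zero_part Q = {} \<or> zero_part Q \<in> Q"
proof (cases "\<exists>B\<in>Q. uminus ` B = B")
  case True
  then show ?thesis using zero_part_block[OF assms] by auto
qed (auto simp: zero_part_def)

text \<open>
  What the insertion argument uses about an admissible block of \<open>n + 1\<close>, whichever of the three ways
  it arises. The last property says that a symmetric block is only added by extending or creating
  the zero block, so that the zero block stays unique.
\<close>

lemma new_blockD:
  assumes Q: "type_B_partition n Q" and D: "D \<in> insert {int (Suc n)} (merged_blocks n Q)"
  defines "Y \<equiv> signed_interval n \<inter> D"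
  shows "int (Suc n) \<in> D"
    and "D \<subseteq> signed_interval (Suc n)"
    and "Y = {} \<or> Y \<in> Q"
    and "uminus ` D = D \<or> D \<inter> uminus ` D = {}"
    and "uminus ` D = D \<Longrightarrow> B \<in> Q \<Longrightarrow> uminus ` B = B \<Longrightarrow> B = Y"
proof -
  let ?m = "int (Suc n)" and ?S = "signed_interval n"
  have m: "?m \<notin> ?S" "- ?m \<notin> ?S" by (auto simp: mem_signed_interval)
  have blk: "B \<subseteq> ?S" if "B \<in> Q" for B
    using type_B_Union[OF Q] that by blast
  have Zsub: "zero_part Q \<subseteq> ?S"
    using zero_part_empty_or_block[OF Q] blk by auto
  consider (singleton) "D = {?m}"
    | (zero) "D = zero_part Q \<union> {?m, - ?m}"
    | (nonzero) X where "X \<in> Q" "uminus ` X \<noteq> X" "D = insert ?m X"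
    using D unfolding merged_blocks_def nonzero_blocks_def by blast
  then have "?m \<in> D \<and> D \<subseteq> signed_interval (Suc n) \<and> (Y = {} \<or> Y \<in> Q) \<and>
     (uminus ` D = D \<or> D \<inter> uminus ` D = {}) \<and>
     (uminus ` D = D \<longrightarrow> B \<in> Q \<longrightarrow> uminus ` B = B \<longrightarrow> B = Y)"
  proof cases
    case singleton
    then show ?thesis
      using m by (auto simp: Y_def mem_signed_interval)
  next
    case zero
    have Y: "Y = zero_part Q"
      using m Zsub unfolding Y_def zero by blast
    have "?m \<in> D" "D \<subseteq> signed_interval (Suc n)"
      using Zsub unfolding zero signed_interval_Suc by auto
    moreover have "uminus ` D = D"
      unfolding zero image_Un uminus_zero_part by auto
    moreover have "uminus ` B = B \<Longrightarrow> B \<in> Q \<Longrightarrow> B = Y"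
      using zero_part_block[OF Q] Y by simp
    ultimately show ?thesis
      using zero_part_empty_or_block[OF Q] Y by simp
  next
    case nonzero
    have Y: "Y = X"
      using m blk[OF nonzero(1)] unfolding Y_def nonzero by blast
    have sub: "?m \<in> D" "D \<subseteq> signed_interval (Suc n)"
      using blk[OF nonzero(1)] unfolding nonzero signed_interval_Suc by auto
    have "- x \<notin> D" if "x \<in> D" for x
    proof -
      have "x \<in> X \<Longrightarrow> - x \<notin> X"
        using type_B_zero_iff[OF Q nonzero(1)] nonzero(2) by simp
      then have "- x \<notin> insert m X" if "m > 0" "- m \<notin> X" "x \<in> insert m X" for m
        using that by auto
      from this[of ?m] show ?thesis
        using that m blk[OF nonzero(1)] unfolding nonzero(3)
        by (meson in_mono of_nat_0_less_iff zero_less_Suc)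
    qed
    then have disj: "D \<inter> uminus ` D = {}"
      by (auto simp: mem_uminus_image_iff)
    with sub(1) have "uminus ` D \<noteq> D" by auto
    with disj sub show ?thesis using Y nonzero(1) by simp
  qed
  then show "?m \<in> D" "D \<subseteq> signed_interval (Suc n)" "Y = {} \<or> Y \<in> Q"
    "uminus ` D = D \<or> D \<inter> uminus ` D = {}"
    "uminus ` D = D \<Longrightarrow> B \<in> Q \<Longrightarrow> uminus ` B = B \<Longrightarrow> B = Y"
    by (simp_all only: simp_thms)
qed

lemma insert_block_type_B:
  assumes Q: "type_B_partition n Q" and D: "D \<in> insert {int (Suc n)} (merged_blocks n Q)"
  shows "type_B_partition (Suc n) (insert_block n Q D)"
proof -
  let ?m = "int (Suc n)" and ?S = "signed_interval n"
  define Y where "Y = ?S \<inter> D"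
  define P where "P = insert_block n Q D"
  note * = new_blockD[OF Q D, folded Y_def]
  have P: "P = (Q - {Y, uminus ` Y}) \<union> {D, uminus ` D}"
    by (simp add: P_def insert_block_def Y_def)
  have Y': "x \<in> uminus ` Y \<longleftrightarrow> x \<in> ?S \<and> - x \<in> D" for x
    by (auto simp: Y_def mem_uminus_image_iff uminus_signed_interval)
  have blk: "B \<subseteq> ?S" if "B \<in> Q" for B
    using type_B_Union[OF Q] that by blast
  have old: "x \<notin> D" "x \<notin> uminus ` D" if B: "B \<in> Q - {Y, uminus ` Y}" "x \<in> B" for B x
  proof -
    have xS: "x \<in> ?S" using blk B by blast
    show "x \<notin> D"
    proof
      assume "x \<in> D"
      then have "x \<in> Y" using xS by (simp add: Y_def)
      then have "B = Y" using *(3) type_B_block_unique[OF Q, of B Y x] B by blast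
      then show False using B by simp
    qed
    show "x \<notin> uminus ` D"
    proof
      assume "x \<in> uminus ` D"
      then have "x \<in> uminus ` Y" using xS unfolding Y' by (simp only: mem_uminus_image_iff simp_thms)
      moreover from this have "uminus ` Y \<in> Q" using *(3) type_B_uminus[OF Q] by blast
      ultimately have "B = uminus ` Y" using type_B_block_unique[OF Q, of B "uminus ` Y" x] B by blast
      then show False using B by simp
    qed
  qed
  have new: "B = D" if "x \<in> D" "x \<in> B" "B \<in> P" for B x
    using that old[of B x] *(4) unfolding P by blast
  have new': "B = uminus ` D" if "x \<in> uminus ` D" "x \<in> B" "B \<in> P" for B x
    using that old[of B x] *(4) unfolding P by blast
  have "partition_on (signed_interval (Suc n)) P"
    unfolding partition_on_iff_unique
  proof (intro conjI ballI allI impI)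
    show "{} \<notin> P" using type_B_nonempty[OF Q] *(1) by (auto simp: P)
    show "\<Union>P = signed_interval (Suc n)"
    proof (intro equalityI subsetI)
      fix x assume "x \<in> \<Union>P"
      then obtain B where B: "B \<in> P" "x \<in> B" by blast
      consider "B \<in> Q" | "B = D" | "B = uminus ` D" using B(1) unfolding P by blast
      then show "x \<in> signed_interval (Suc n)"
      proof cases
        case 1
        then show ?thesis using blk B(2) unfolding signed_interval_Suc by blast
      next
        case 2
        then show ?thesis using *(2) B(2) by blast
      next
        case 3
        then have "- x \<in> D" using B(2) by (simp add: mem_uminus_image_iff)
        then show ?thesis using *(2) uminus_signed_interval by blast
      qed
    next
      fix x assume x: "x \<in> signed_interval (Suc n)"
      show "x \<in> \<Union>P"
      proof (cases "x \<in> D \<or> - x \<in> D")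
        case True
        then have "x \<in> D \<or> x \<in> uminus ` D" by (simp add: mem_uminus_image_iff)
        then show ?thesis unfolding P by blast
      next
        case False
        then have "x \<noteq> ?m" "x \<noteq> - ?m" using *(1) minus_minus[of ?m] by metis+
        then have "x \<in> ?S" using x unfolding signed_interval_Suc by blast
        then obtain B where "B \<in> Q" "x \<in> B" using type_B_Union[OF Q] by blast
        moreover have "x \<notin> Y" "x \<notin> uminus ` Y" using False Y'[of x] unfolding Y_def by blast+
        ultimately show ?thesis unfolding P by blast
      qed
    qed
    fix B C x assume BC: "B \<in> P" "C \<in> P" "x \<in> B" "x \<in> C"
    consider "x \<in> D" | "x \<in> uminus ` D" | "x \<notin> D" "x \<notin> uminus ` D" by blast
    then show "B = C"
    proof cases
      case 1
      then show ?thesis using new BC by metis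
    next
      case 2
      then show ?thesis using new' BC by metis
    next
      case 3
      then have "B \<in> Q" "C \<in> Q" using BC unfolding P by blast+
      then show ?thesis using type_B_block_unique[OF Q] BC by metis
    qed
  qed
  moreover have "\<forall>B\<in>P. uminus ` B \<in> P"
  proof
    fix B assume "B \<in> P"
    then consider "B \<in> Q" "B \<noteq> Y" "B \<noteq> uminus ` Y" | "B = D" | "B = uminus ` D" unfolding P by blast
    then show "uminus ` B \<in> P"
    proof cases
      case 1
      then have "uminus ` B \<noteq> Y" "uminus ` B \<noteq> uminus ` Y"
        using uminus_uminus_image by metis+
      then show ?thesis using type_B_uminus[OF Q 1(1)] unfolding P by simp
    qed (simp_all add: P uminus_uminus_image)
  qed
  moreover have "\<forall>B\<in>P. \<forall>C\<in>P. uminus ` B = B \<longrightarrow> uminus ` C = C \<longrightarrow> B = C"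
  proof (cases "uminus ` D = D")
    case True
    have "B = D" if B: "B \<in> P" "uminus ` B = B" for B
    proof (rule ccontr)
      assume "B \<noteq> D"
      then have "B \<in> Q" "B \<noteq> Y" using B(1) True unfolding P by simp_all
      then show False using *(5)[OF True _ B(2)] by simp
    qed
    then show ?thesis by metis
  next
    case False
    have "B \<in> Q" if B: "B \<in> P" "uminus ` B = B" for B
    proof (rule ccontr)
      assume "B \<notin> Q"
      then have "B = D \<or> B = uminus ` D" using B(1) unfolding P by simp
      then show False using B(2) False uminus_uminus_image[of D] by metis
    qed
    then show ?thesis using type_B_zero_unique[OF Q] by metis
  qed
  ultimately show ?thesis
    unfolding type_B_partition_def P_def by (intro conjI)
qed

lemma delete_largest_insert_block:
  assumes Q: "type_B_partition n Q" and D: "D \<in> insert {int (Suc n)} (merged_blocks n Q)"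
  shows "delete_largest n (insert_block n Q D) = Q"
proof -
  let ?S = "signed_interval n"
  define Y where "Y = ?S \<inter> D"
  note * = new_blockD(3)[OF Q D, folded Y_def]
  have blk: "?S \<inter> B = B" if "B \<in> Q" for B
    using type_B_Union[OF Q] that by blast
  have Y': "?S \<inter> uminus ` D = uminus ` Y"
    by (simp add: Y_def uminus_Int_signed_interval)
  have "(\<inter>) ?S ` (Q - {Y, uminus ` Y}) = Q - {Y, uminus ` Y}"
    using blk by simp
  then have "delete_largest n (insert_block n Q D) = (Q - {Y, uminus ` Y} \<union> {Y, uminus ` Y}) - {{}}"
    unfolding delete_largest_def insert_block_def image_Un
    by (simp add: Y'[symmetric] Y_def[symmetric])
  also have "\<dots> = (Q \<union> {Y, uminus ` Y}) - {{}}" by blast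
  also have "\<dots> = Q"
  proof (cases "Y = {}")
    case True
    then show ?thesis using type_B_nonempty[OF Q] by auto
  next
    case False
    then have "Y \<in> Q" "uminus ` Y \<in> Q" using * type_B_uminus[OF Q] by simp_all
    then show ?thesis using type_B_nonempty[OF Q] by auto
  qed
  finally show ?thesis .
qed

text \<open>
  Both arguments can be recovered: \<open>D\<close> is the block of \<open>n + 1\<close>, and deletion returns \<open>Q\<close>.
\<close>

lemma inj_on_insert_block:
  "inj_on (\<lambda>(Q, D). insert_block n Q D)
     (SIGMA Q : {Q. type_B_partition n Q}. insert {int (Suc n)} (merged_blocks n Q))"
proof (rule inj_onI, clarify)
  fix Q D Q' D'
  assume Q: "type_B_partition n Q" "D \<in> insert {int (Suc n)} (merged_blocks n Q)"
    and Q': "type_B_partition n Q'" "D' \<in> insert {int (Suc n)} (merged_blocks n Q')"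
    and eq: "insert_block n Q D = insert_block n Q' D'"
  have "D \<in> insert_block n Q D" "D' \<in> insert_block n Q' D'"
    by (simp_all add: insert_block_def)
  then have "D = D'"
    unfolding eq[symmetric]
    using type_B_block_unique[OF insert_block_type_B[OF Q]] new_blockD(1)[OF Q] new_blockD(1)[OF Q']
    by metis
  moreover have "Q = Q'"
    using delete_largest_insert_block[OF Q] delete_largest_insert_block[OF Q'] eq by simp
  ultimately show "Q = Q' \<and> D = D'" by simp
qed

lemma image_insert_block:
  "(\<lambda>(Q, D). insert_block n Q D) `
     (SIGMA Q : {Q. type_B_partition n Q}. insert {int (Suc n)} (merged_blocks n Q))
   = {P. type_B_partition (Suc n) P}" (is "?f ` ?A = _")
proof (intro equalityI subsetI)
  fix P assume "P \<in> {P. type_B_partition (Suc n) P}"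
  then have P: "type_B_partition (Suc n) P" by simp
  have "int (Suc n) \<in> \<Union>P"
    unfolding type_B_Union[OF P] by (simp add: mem_signed_interval)
  then obtain D where D: "D \<in> P" "int (Suc n) \<in> D" by blast
  have "(delete_largest n P, D) \<in> ?A"
    using delete_largest_type_B[OF P] largest_block_cases[OF P D] by simp
  moreover have "P = ?f (delete_largest n P, D)"
    using insert_block_delete_largest[OF P D] by simp
  ultimately show "P \<in> ?f ` ?A" by (rule rev_image_eqI)
next
  fix P assume "P \<in> ?f ` ?A"
  then obtain Q D where "P = insert_block n Q D" "type_B_partition n Q"
    "D \<in> insert {int (Suc n)} (merged_blocks n Q)" by auto
  then show "P \<in> {P. type_B_partition (Suc n) P}"
    using insert_block_type_B by simp
qed

section \<open>Effect on the statistics\<close>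

lemma r_separated_insert_block:
  assumes Q: "type_B_partition n Q" and D: "D \<in> insert {int (Suc n)} (merged_blocks n Q)"
    and "r \<le> n"
  shows "r_separated r (insert_block n Q D) \<longleftrightarrow> r_separated r Q"
proof -
  let ?P = "insert_block n Q D" and ?S = "signed_interval n"
  have sub: "i \<in> ?S" if "i \<in> signed_interval r" for i
    using that \<open>r \<le> n\<close> by (auto simp: mem_signed_interval)
  have P: "type_B_partition (Suc n) ?P" by (rule insert_block_type_B[OF Q D])
  have "r \<le> Suc n" using \<open>r \<le> n\<close> by simp
  note sepP = r_separated_iff[OF P this] and sepQ = r_separated_iff[OF Q \<open>r \<le> n\<close>]
  have del: "Q = (\<inter>) ?S ` ?P - {{}}"
    using delete_largest_insert_block[OF Q D] unfolding delete_largest_def by simp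
  show ?thesis
    unfolding sepP sepQ
  proof (intro iffI ballI impI)
    fix B i j
    assume P': "\<forall>B\<in>?P. \<forall>i\<in>signed_interval r. \<forall>j\<in>signed_interval r. i \<in> B \<longrightarrow> j \<in> B \<longrightarrow> i = j"
      and B: "B \<in> Q" "i \<in> signed_interval r" "j \<in> signed_interval r" "i \<in> B" "j \<in> B"
    from B(1) obtain B' where "B' \<in> ?P" "B = ?S \<inter> B'" using del by blast
    then show "i = j" using P' B by blast
  next
    fix B i j
    assume Q': "\<forall>B\<in>Q. \<forall>i\<in>signed_interval r. \<forall>j\<in>signed_interval r. i \<in> B \<longrightarrow> j \<in> B \<longrightarrow> i = j"
      and B: "B \<in> ?P" "i \<in> signed_interval r" "j \<in> signed_interval r" "i \<in> B" "j \<in> B"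
    have mem: "i \<in> ?S \<inter> B" "j \<in> ?S \<inter> B" using B sub by simp_all
    then have "?S \<inter> B \<in> (\<inter>) ?S ` ?P - {{}}" using B(1) by blast
    then have "?S \<inter> B \<in> Q" unfolding del[symmetric] .
    from Q'[rule_format, OF this B(2,3) mem] show "i = j" .
  qed
qed

lemma finite_nonzero_blocks:
  assumes "type_B_partition n P"
  shows "finite (nonzero_blocks P)"
  using finite_type_B_partition[OF assms] by (simp add: nonzero_blocks_def)

lemma nonzero_blocks_Un: "nonzero_blocks (P \<union> Q) = nonzero_blocks P \<union> nonzero_blocks Q"
  unfolding nonzero_blocks_def by blast

lemma nonzero_blocks_Diff: "nonzero_blocks (P - Q) = nonzero_blocks P - Q"
  unfolding nonzero_blocks_def by blast

lemma nonzero_blocks_pair: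
  "nonzero_blocks {D, uminus ` D} = (if uminus ` D = D then {} else {D, uminus ` D})"
proof (rule set_eqI)
  fix B
  have "B \<in> nonzero_blocks {D, uminus ` D} \<longleftrightarrow> (B = D \<or> B = uminus ` D) \<and> uminus ` B \<noteq> B"
    unfolding nonzero_blocks_def by (simp only: mem_Collect_eq insert_iff empty_iff simp_thms)
  also have "\<dots> \<longleftrightarrow> B \<in> (if uminus ` D = D then {} else {D, uminus ` D})"
    by (metis uminus_uminus_image insert_iff empty_iff)
  finally show "B \<in> nonzero_blocks {D, uminus ` D} \<longleftrightarrow> \<dots>" .
qed

text \<open>
  A singleton adds itself and its negative. Extending the zero block leaves the non-zero blocks
  alone, and extending a non-zero block replaces one pair by another.
\<close>

lemma card_nonzero_blocks_insert_block:
  assumes Q: "type_B_partition n Q" and D: "D \<in> insert {int (Suc n)} (merged_blocks n Q)"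
  shows "card (nonzero_blocks (insert_block n Q D)) =
    card (nonzero_blocks Q) + (if D = {int (Suc n)} then 2 else 0)"
proof -
  let ?m = "int (Suc n)" and ?S = "signed_interval n"
  define Y where "Y = ?S \<inter> D"
  have m: "?m \<notin> ?S" "- ?m \<notin> ?S" by (auto simp: mem_signed_interval)
  have blk: "B \<subseteq> ?S" if "B \<in> Q" for B
    using type_B_Union[OF Q] that by blast
  have nz: "nonzero_blocks (insert_block n Q D) =
      (nonzero_blocks Q - {Y, uminus ` Y}) \<union> (if uminus ` D = D then {} else {D, uminus ` D})"
    unfolding insert_block_def nonzero_blocks_Un nonzero_blocks_Diff nonzero_blocks_pair Y_def ..
  have fin: "finite (nonzero_blocks Q)" by (rule finite_nonzero_blocks[OF Q])
  have mD: "?m \<in> D" by (rule new_blockD(1)[OF Q D])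
  have "- ?m \<in> uminus ` D" using mD by (rule imageI)
  then have new: "nonzero_blocks Q \<inter> {D, uminus ` D} = {}"
    using blk m mD unfolding nonzero_blocks_def by blast
  have two: "card {B, uminus ` B} = 2" if "uminus ` B \<noteq> B" for B :: "int set"
    using that by (metis card_2_iff)
  consider (singleton) "D = {?m}"
    | (zero) "D = zero_part Q \<union> {?m, - ?m}"
    | (nonzero) X where "X \<in> nonzero_blocks Q" "D = insert ?m X"
    using D unfolding merged_blocks_def by blast
  then show ?thesis
  proof cases
    case singleton
    have "Y = {}" using m singleton by (simp add: Y_def)
    moreover have "{} \<notin> nonzero_blocks Q"
      using type_B_nonempty[OF Q] unfolding nonzero_blocks_def by blast
    moreover have neq: "uminus ` D \<noteq> D" unfolding singleton by simp
    ultimately have "nonzero_blocks (insert_block n Q D) = nonzero_blocks Q \<union> {D, uminus ` D}"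
      unfolding nz by simp
    then have "card (nonzero_blocks (insert_block n Q D)) = card (nonzero_blocks Q) + 2"
      using card_Un_disjoint[OF fin _ new] two[OF neq] by simp
    then show ?thesis using singleton by simp
  next
    case zero
    have Y: "Y = zero_part Q"
      using zero_part_empty_or_block[OF Q] m blk unfolding Y_def zero by blast
    have "uminus ` D = D"
      unfolding zero image_Un uminus_zero_part by auto
    moreover have "uminus ` Y = Y" "Y \<notin> nonzero_blocks Q"
      unfolding Y nonzero_blocks_def using uminus_zero_part by simp_all
    ultimately have "nonzero_blocks (insert_block n Q D) = nonzero_blocks Q"
      unfolding nz by simp
    moreover have "D \<noteq> {?m}" unfolding zero by auto
    ultimately show ?thesis by simp
  next
    case (nonzero X)
    have X: "X \<in> Q" "uminus ` X \<noteq> X" using nonzero(1) unfolding nonzero_blocks_def by blast+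
    have Y: "Y = X" using m blk[OF X(1)] unfolding Y_def nonzero by blast
    have "uminus ` X \<in> nonzero_blocks Q"
      using type_B_uminus[OF Q X(1)] X(2) unfolding nonzero_blocks_def
      by (metis (mono_tags, lifting) mem_Collect_eq uminus_uminus_image)
    then have sub: "{X, uminus ` X} \<subseteq> nonzero_blocks Q" using nonzero(1) by simp
    have "- ?m \<notin> D" using m blk[OF X(1)] unfolding nonzero by auto
    then have neq: "uminus ` D \<noteq> D" using \<open>- ?m \<in> uminus ` D\<close> by metis
    have "card (nonzero_blocks (insert_block n Q D)) =
        card (nonzero_blocks Q - {X, uminus ` X}) + card {D, uminus ` D}"
      unfolding nz Y if_not_P[OF neq]
      by (rule card_Un_disjoint) (use fin new in auto)
    also have "\<dots> = card (nonzero_blocks Q) - 2 + 2"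
      using card_Diff_subset[OF _ sub] two[OF neq] two[OF X(2)] by simp
    also have "\<dots> = card (nonzero_blocks Q)"
      using card_mono[OF fin sub] two[OF X(2)] by simp
    finally have "card (nonzero_blocks (insert_block n Q D)) = card (nonzero_blocks Q)" .
    moreover have "D \<noteq> {?m}"
      using type_B_nonempty[OF Q X(1)] m blk[OF X(1)] unfolding nonzero by blast
    ultimately show ?thesis by simp
  qed
qed

lemma card_nonzero_block_pairs_insert_block:
  assumes Q: "type_B_partition n Q" and D: "D \<in> insert {int (Suc n)} (merged_blocks n Q)"
  shows "card (nonzero_block_pairs (insert_block n Q D)) =
    card (nonzero_block_pairs Q) + (if D = {int (Suc n)} then 1 else 0)"
  using card_nonzero_blocks_insert_block[OF Q D] card_nonzero_blocks[OF Q]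
    card_nonzero_blocks[OF insert_block_type_B[OF Q D]] by (simp split: if_splits)

lemma singleton_notin_merged_blocks:
  assumes Q: "type_B_partition n Q"
  shows "{int (Suc n)} \<notin> merged_blocks n Q"
proof
  let ?m = "int (Suc n)"
  assume "{?m} \<in> merged_blocks n Q"
  then consider "{?m} = zero_part Q \<union> {?m, - ?m}"
    | X where "X \<in> Q" "{?m} = insert ?m X"
    unfolding merged_blocks_def nonzero_blocks_def by blast
  then show False
  proof cases
    case 1
    then have "- ?m \<in> {?m}" by blast
    then show ?thesis by simp
  next
    case 2
    then have "?m \<in> X" using type_B_nonempty[OF Q] by blast
    then have "?m \<in> signed_interval n" using 2 type_B_Union[OF Q] by blast
    then show ?thesis by (simp add: mem_signed_interval)
  qed
qed

text \<open>
  Each of the two blocks of a pair can be extended, and there is one more choice for the zero block.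
\<close>

lemma card_merged_blocks:
  assumes Q: "type_B_partition n Q"
  shows "card (merged_blocks n Q) = 2 * card (nonzero_block_pairs Q) + 1"
proof -
  let ?m = "int (Suc n)"
  have blk: "?m \<notin> B" "- ?m \<notin> B" if "B \<in> nonzero_blocks Q" for B
  proof -
    have "B \<subseteq> signed_interval n"
      using type_B_Union[OF Q] that unfolding nonzero_blocks_def by blast
    then show "?m \<notin> B" "- ?m \<notin> B" by (auto simp: mem_signed_interval)
  qed
  have fin: "finite (nonzero_blocks Q)" by (rule finite_nonzero_blocks[OF Q])
  have "- ?m \<notin> D" if "D \<in> insert ?m ` nonzero_blocks Q" for D
    using that blk(2) by auto
  then have "zero_part Q \<union> {?m, - ?m} \<notin> insert ?m ` nonzero_blocks Q" by blast
  then have "card (merged_blocks n Q) = Suc (card (insert ?m ` nonzero_blocks Q))"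
    unfolding merged_blocks_def using fin by simp
  also have "inj_on (insert ?m) (nonzero_blocks Q)"
    using blk(1) by (intro inj_onI) (metis insert_ident)
  then have "card (insert ?m ` nonzero_blocks Q) = card (nonzero_blocks Q)"
    by (rule card_image)
  finally show ?thesis using card_nonzero_blocks[OF Q] by simp
qed

section \<open>The recurrence\<close>

definition r_partitions_B :: "nat \<Rightarrow> nat \<Rightarrow> nat \<Rightarrow> int set set set" where
  "r_partitions_B n k r =
     {P. type_B_partition n P \<and> card (nonzero_block_pairs P) = k \<and> r_separated r P}"

lemma finite_r_partitions_B: "finite (r_partitions_B n k r)"
  unfolding r_partitions_B_def by (rule finite_subset[OF _ finite_type_B_partitions]) blast

text \<open>
  Insertion is restricted to the pairs \<open>(Q, D)\<close> whose image has \<open>k\<close> pairs of non-zero blocks: either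
  \<open>D\<close> is the singleton and \<open>Q\<close> has \<open>k - 1\<close> pairs, or \<open>Q\<close> has \<open>k\<close> pairs and \<open>D\<close> is one of the
  \<open>2 * k + 1\<close> merged blocks.
\<close>

lemma r_Stirling_B_Suc:
  assumes "r \<le> n"
  shows "r_Stirling_B (Suc n) k r =
    (if k = 0 then 0 else r_Stirling_B n (k - 1) r) + (2 * k + 1) * r_Stirling_B n k r"
proof -
  define f where "f = (\<lambda>(Q, D). insert_block n Q D)"
  define all where
    "all = (SIGMA Q : {Q. type_B_partition n Q}. insert {int (Suc n)} (merged_blocks n Q))"
  \<comment> \<open>The singleton creates a pair of non-zero blocks, so that \<open>k = 0\<close> rules it out;
    the truncated \<open>k - 1\<close> would count the partitions with \<open>k = 0\<close> instead.\<close>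
  define fresh where
    "fresh = (if k = 0 then {} else r_partitions_B n (k - 1) r) \<times> {{int (Suc n)}}"
  define merged where "merged = (SIGMA Q : r_partitions_B n k r. merged_blocks n Q)"
  have inj: "inj_on f all"
    unfolding f_def all_def by (rule inj_on_insert_block)
  have im: "f ` all = {P. type_B_partition (Suc n) P}"
    unfolding f_def all_def by (rule image_insert_block)
  have sub: "fresh \<union> merged \<subseteq> all"
    unfolding fresh_def merged_def all_def r_partitions_B_def by (auto split: if_splits)
  have iff: "f x \<in> r_partitions_B (Suc n) k r \<longleftrightarrow> x \<in> fresh \<union> merged" if "x \<in> all" for x
  proof -
    obtain Q D where x: "x = (Q, D)" by (cases x)
    have Q: "type_B_partition n Q" and D: "D \<in> insert {int (Suc n)} (merged_blocks n Q)"
      using that unfolding all_def x by auto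
    have "f x \<in> r_partitions_B (Suc n) k r \<longleftrightarrow> r_separated r Q \<and>
        card (nonzero_block_pairs Q) + (if D = {int (Suc n)} then 1 else 0) = k"
      unfolding f_def x r_partitions_B_def
      using insert_block_type_B[OF Q D] card_nonzero_block_pairs_insert_block[OF Q D]
        r_separated_insert_block[OF Q D assms] by auto
    also have "\<dots> \<longleftrightarrow> x \<in> fresh \<union> merged"
      using Q D singleton_notin_merged_blocks[OF Q]
      unfolding fresh_def merged_def r_partitions_B_def x by (auto split: if_splits)
    finally show ?thesis .
  qed
  have "r_partitions_B (Suc n) k r \<subseteq> f ` all"
    unfolding im r_partitions_B_def by blast
  then have "r_partitions_B (Suc n) k r = f ` (fresh \<union> merged)"
    using iff sub by blast
  then have "r_Stirling_B (Suc n) k r = card (f ` (fresh \<union> merged))"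
    unfolding r_Stirling_B_def r_partitions_B_def by simp
  also have "\<dots> = card (fresh \<union> merged)"
    by (rule card_image[OF inj_on_subset[OF inj sub]])
  also have "\<dots> = card fresh + card merged"
  proof (rule card_Un_disjoint)
    show "finite fresh"
      unfolding fresh_def using finite_r_partitions_B by simp
    have "finite (merged_blocks n Q)" if "type_B_partition n Q" for Q
      unfolding merged_blocks_def using finite_nonzero_blocks[OF that] by simp
    then show "finite merged"
      unfolding merged_def
      by (intro finite_SigmaI finite_r_partitions_B) (simp add: r_partitions_B_def)
    show "fresh \<inter> merged = {}"
      unfolding fresh_def merged_def r_partitions_B_def
      using singleton_notin_merged_blocks by blast
  qed
  also have "card fresh = (if k = 0 then 0 else r_Stirling_B n (k - 1) r)"
    unfolding fresh_def r_Stirling_B_def r_partitions_B_def by (simp add: card_cartesian_product)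
  also have "card merged = (\<Sum>Q\<in>r_partitions_B n k r. card (merged_blocks n Q))"
    unfolding merged_def
    by (rule card_SigmaI) (use finite_r_partitions_B finite_nonzero_blocks in
        \<open>auto simp: merged_blocks_def r_partitions_B_def\<close>)
  also have "\<dots> = (\<Sum>Q\<in>r_partitions_B n k r. 2 * k + 1)"
    by (rule sum.cong) (auto simp: r_partitions_B_def card_merged_blocks)
  also have "\<dots> = (2 * k + 1) * r_Stirling_B n k r"
    unfolding r_Stirling_B_def r_partitions_B_def by simp
  finally show ?thesis .
qed

lemma r_Stirling_B_diag: "r_Stirling_B r k r = (if k = r then 1 else 0)"
proof -
  define P0 where "P0 = (\<lambda>i. {i}) ` signed_interval r"
  have P0: "type_B_partition r P0"
    unfolding type_B_partition_def
  proof (intro conjI)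
    show "partition_on (signed_interval r) P0"
      unfolding partition_on_iff_unique P0_def by auto
    show "\<forall>B\<in>P0. uminus ` B \<in> P0"
      unfolding P0_def by (auto simp: uminus_signed_interval)
    have "uminus ` B \<noteq> B" if "B \<in> P0" for B
      using that unfolding P0_def by (auto simp: mem_signed_interval)
    then show "\<forall>B\<in>P0. \<forall>C\<in>P0. uminus ` B = B \<longrightarrow> uminus ` C = C \<longrightarrow> B = C"
      by blast
  qed
  have "nonzero_blocks P0 = P0"
    unfolding nonzero_blocks_def P0_def by (auto simp: mem_signed_interval)
  moreover have "card P0 = 2 * r"
    unfolding P0_def by (subst card_image) (auto simp: signed_interval_def)
  ultimately have k0: "card (nonzero_block_pairs P0) = r"
    using card_nonzero_blocks[OF P0] by simp
  have unique: "P = P0" if P: "type_B_partition r P" and "r_separated r P" for P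
  proof -
    have sep: "i = j" if "B \<in> P" "i \<in> B" "j \<in> B" for B i j
      using that \<open>r_separated r P\<close> type_B_Union[OF P]
      unfolding r_separated_iff[OF P order.refl] by blast
    show ?thesis
    proof (intro equalityI subsetI)
      fix B assume B: "B \<in> P"
      then obtain i where i: "i \<in> B" using type_B_nonempty[OF P] by blast
      then have "B = {i}" using sep[OF B] by blast
      moreover have "i \<in> signed_interval r" using type_B_Union[OF P] B i by blast
      ultimately show "B \<in> P0" unfolding P0_def by blast
    next
      fix B assume "B \<in> P0"
      then obtain i where i: "i \<in> signed_interval r" "B = {i}" unfolding P0_def by blast
      then obtain C where C: "C \<in> P" "i \<in> C" using type_B_Union[OF P] by blast
      then have "C = {i}" using sep[OF C(1)] by blast
      then show "B \<in> P" using C i by simp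
    qed
  qed
  have sep0: "r_separated r P0"
    unfolding r_separated_iff[OF P0 order.refl] by (simp add: P0_def)
  have "type_B_partition r P \<and> card (nonzero_block_pairs P) = k \<and> r_separated r P \<longleftrightarrow>
      P = P0 \<and> k = r" for P
    using unique P0 sep0 k0 by metis
  then show ?thesis unfolding r_Stirling_B_def by simp
qed

text \<open>
  The induction in \<open>of_nat_r_Stirling_B\<close> needs this: there, for \<open>k = 0\<close>, the recurrence refers to
  partitions with \<open>r - 1\<close> pairs, for which the generating functions have no counterpart.
\<close>

lemma r_Stirling_B_eq_0:
  assumes "k < r"
  shows "r_Stirling_B (n + r) k r = 0"
  using assms
proof (induction n arbitrary: k)
  case (Suc n)
  then show ?case by (simp add: r_Stirling_B_Suc)
qed (simp add: r_Stirling_B_diag)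

section \<open>The generating function\<close>

definition r_Stirling_B_egf :: "nat \<Rightarrow> nat \<Rightarrow> 'a :: field_char_0 fps" where
  "r_Stirling_B_egf k r =
     fps_const (1 / (fact k * 2 ^ k)) * fps_exp (of_nat (2 * r + 1)) * (fps_exp 2 - 1) ^ k"

text \<open>
  Differentiating the power of \<open>X - 1\<close>, where \<open>X = exp (2 z)\<close>, produces a factor \<open>2 * k * X\<close>.
  Writing \<open>X = (X - 1) + 1\<close> splits it into the multiple of \<open>F k\<close> and the term \<open>F (k - 1)\<close>; the
  normalisation \<open>1 / (k! * 2 ^ k)\<close> makes the latter's coefficient \<open>1\<close>.
\<close>

lemma r_Stirling_B_egf_deriv:
  "fps_deriv (r_Stirling_B_egf k r :: 'a :: field_char_0 fps) =
     (if k = 0 then 0 else r_Stirling_B_egf (k - 1) r) +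
     of_nat (2 * (k + r) + 1) * r_Stirling_B_egf k r"
proof -
  define E :: "'a fps" where "E = fps_exp (of_nat (2 * r + 1))"
  define X :: "'a fps" where "X = fps_exp 2"
  define c :: "nat \<Rightarrow> 'a fps" where "c = (\<lambda>k. fps_const (1 / (fact k * 2 ^ k)))"
  have F: "r_Stirling_B_egf k r = c k * E * (X - 1) ^ k" for k
    by (simp add: r_Stirling_B_egf_def E_def X_def c_def)
  have dE: "fps_deriv E = of_nat (2 * r + 1) * E"
    unfolding E_def fps_exp_deriv fps_of_nat ..
  have dX: "fps_deriv X = 2 * X"
    unfolding X_def fps_exp_deriv by (simp add: numeral_fps_const)
  have dc: "fps_deriv (c k) = 0" for k
    by (simp add: c_def)
  show ?thesis
  proof (cases k)
    case 0
    then show ?thesis by (simp add: F dE dc)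
  next
    case (Suc j)
    have c: "c j = of_nat (2 * Suc j) * c (Suc j)"
    proof -
      have "1 / (fact j * 2 ^ j) = (of_nat (2 * Suc j) * (1 / (fact (Suc j) * 2 ^ Suc j)) :: 'a)"
        by (simp add: field_simps del: of_nat_Suc) simp
      then show ?thesis
        unfolding c_def fps_of_nat[symmetric] fps_const_mult by simp
    qed
    have dpow: "fps_deriv ((X - 1) ^ Suc j) = of_nat (Suc j) * (2 * X) * (X - 1) ^ j"
      using dX unfolding fps_deriv_power fps_of_nat diff_Suc_1 by simp
    have "fps_deriv (r_Stirling_B_egf k r) =
        c (Suc j) * (of_nat (2 * r + 1) * E * (X - 1) ^ Suc j
          + E * (of_nat (Suc j) * (2 * X) * (X - 1) ^ j))"
      unfolding F Suc by (simp only: fps_deriv_mult dE dpow dc) (simp only: algebra_simps mult_zero_left mult_zero_right add_0_left)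
    also have "\<dots> = of_nat (2 * Suc j) * c (Suc j) * E * (X - 1) ^ j +
        of_nat (2 * (Suc j + r) + 1) * (c (Suc j) * E * (X - 1) ^ Suc j)"
      by (simp add: algebra_simps)
    finally show ?thesis
      unfolding c[symmetric] by (simp add: Suc F)
  qed
qed

lemma r_Stirling_B_egf_nth_0:
  "fps_nth (r_Stirling_B_egf k r :: 'a :: field_char_0 fps) 0 = (if k = 0 then 1 else 0)"
  by (simp add: r_Stirling_B_egf_def fps_nth_power_0)

lemma of_nat_r_Stirling_B:
  "of_nat (r_Stirling_B (n + r) (k + r) r) =
     fact n * fps_nth (r_Stirling_B_egf k r :: 'a :: field_char_0 fps) n"
proof (induction n arbitrary: k)
  case 0
  then show ?case by (simp add: r_Stirling_B_diag r_Stirling_B_egf_nth_0)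
next
  case (Suc n)
  let ?F = "\<lambda>k. r_Stirling_B_egf k r :: 'a fps"
  have pred: "of_nat (if k + r = 0 then 0 else r_Stirling_B (n + r) (k + r - 1) r) =
      fact n * fps_nth (if k = 0 then 0 else ?F (k - 1)) n"
  proof (cases k)
    case 0
    then show ?thesis using r_Stirling_B_eq_0[of "r - 1" r n] by simp
  next
    case (Suc j)
    then show ?thesis using Suc.IH[of j] by simp
  qed
  have "of_nat (r_Stirling_B (Suc n + r) (k + r) r) =
      of_nat (if k + r = 0 then 0 else r_Stirling_B (n + r) (k + r - 1) r) +
      of_nat (2 * (k + r) + 1) * (of_nat (r_Stirling_B (n + r) (k + r) r) :: 'a)"
    unfolding add_Suc r_Stirling_B_Suc[OF le_add2] by (simp only: of_nat_add of_nat_mult)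
  also have "\<dots> = fact n * (fps_nth (if k = 0 then 0 else ?F (k - 1)) n
      + of_nat (2 * (k + r) + 1) * fps_nth (?F k) n)"
    unfolding pred Suc.IH by (simp only: algebra_simps)
  also have "\<dots> = fact n * fps_nth (fps_deriv (?F k)) n"
    unfolding r_Stirling_B_egf_deriv fps_add_nth fps_of_nat[symmetric] fps_mult_left_const_nth ..
  also have "\<dots> = fact (Suc n) * fps_nth (?F k) (Suc n)"
    by simp
  finally show ?case .
qed

text \<open>
  The series \<open>F k\<close> starts at \<open>z ^ k\<close>, which accounts for the summation from \<open>n = k\<close>.
\<close>

lemma r_Stirling_B_egf_nth_less:
  assumes "n < k"
  shows "fps_nth (r_Stirling_B_egf k r :: 'a :: field_char_0 fps) n = 0"
  using assms
proof (induction n arbitrary: k)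
  case 0
  then show ?case by (simp add: r_Stirling_B_egf_nth_0)
next
  case (Suc n)
  have "fps_nth (fps_deriv (r_Stirling_B_egf k r :: 'a fps)) n = 0"
    unfolding r_Stirling_B_egf_deriv fps_add_nth fps_of_nat[symmetric] fps_mult_left_const_nth
    using Suc.IH[of k] Suc.IH[of "k - 1"] Suc.prems by simp
  then show ?case by (simp del: of_nat_Suc)
qed

theorem theorem4p3:
  fixes k r :: nat
  shows "Abs_fps (\<lambda>n. if k \<le> n
             then of_nat (r_Stirling_B (n + r) (k + r) r) / fact n
             else (0 :: 'a :: field_char_0))
         = fps_const (1 / (fact k * 2 ^ k)) * fps_exp (of_nat (2 * r + 1)) * (fps_exp 2 - 1) ^ k"
proof -
  have "Abs_fps (\<lambda>n. if k \<le> n then of_nat (r_Stirling_B (n + r) (k + r) r) / fact n else (0 :: 'a))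
      = r_Stirling_B_egf k r"
    by (rule fps_ext) (simp add: of_nat_r_Stirling_B r_Stirling_B_egf_nth_less)
  then show ?thesis unfolding r_Stirling_B_egf_def .
qed

end
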